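(* For every complex number $q$ with $0<|q|<1$, \[ \sum_{k=1}^{\infty}q^{2k^2}[8k+1]\frac{(q;q^2)_{k}^2(q;q^2)_{2k}}{(q^2;q^2)_{2k}(q^6;q^6)_{k}^2}\sum_{i=1}^{k}\left\{\frac{q^{2i-1}}{[2i-1]^2}-\frac{q^{6i}}{[6i]^2}\right\} =\frac{(q^3;q^2)_{\infty}(q^3;q^6)_{\infty}}{(q^2;q^2)_{\infty}(q^6;q^6)_{\infty}}\sum_{j=1}^{\infty}(-1)^{j-1}\frac{q^{3j}}{[3j]^2}. \]
   Context: For complex $x,q$ with $|q|<1$: $(x;q)_\infty=\prod_{i\ge 0}(1-xq^i)$ and, for an integer $n\ge 0$, $(x;q)_n=\prod_{i=0}^{n-1}(1-xq^i)$. Multiple arguments mean products: $(x_1,\dots,x_r;q)_m=(x_1;q)_m\cdots(x_r;q)_m$. The $q$-integer is $[n]=1+q+\cdots+q^{n-1}=(1-q^n)/(1-q)$. *)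

theory Defs
  imports "HOL-Analysis.Analysis"
begin

definition qpoch :: "complex \<Rightarrow> complex \<Rightarrow> nat \<Rightarrow> complex" where
  "qpoch x q n = (\<Prod>i<n. 1 - x * q ^ i)"

definition qpoch_inf :: "complex \<Rightarrow> complex \<Rightarrow> complex" where
  "qpoch_inf x q = (\<Prod>i. 1 - x * q ^ i)"

definition qint :: "complex \<Rightarrow> nat \<Rightarrow> complex" where
  "qint q n = (\<Sum>i<n. q ^ i)"

end

theory Submission
  imports Defs "HOL-Complex_Analysis.Complex_Analysis"
begin

text \<open>
  Deform the summand by two parameters: replace \<open>(q;q\<^sup>2)\<^sub>k\<^sup>2\<close> by \<open>(qx,q/x;q\<^sup>2)\<^sub>k\<close>, \<open>(q;q\<^sup>2)\<^sub>2\<^sub>k\<close> by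
  \<open>(qd;q\<^sup>2)\<^sub>2\<^sub>k\<close>, and \<open>(q\<^sup>6;q\<^sup>6)\<^sub>k\<^sup>2\<close> by \<open>(dq\<^sup>6x,dq\<^sup>6/x;q\<^sup>6)\<^sub>k\<close>. A WZ pair in \<open>k\<close> and \<open>d\<close> shows that the
  series \<open>S(d)\<close> satisfies a first order recurrence under \<open>d \<mapsto> dq\<^sup>6\<close>. Iterating it from \<open>d = 1\<close> and
  from \<open>d = q\<^sup>3\<close>, where the series telescopes outright, expresses \<open>S(0)\<close> in two ways, which
  evaluates \<open>S(1)\<close> as an infinite product. By the symmetry \<open>x \<leftrightarrow> 1/x\<close> everything depends only on
  \<open>u = x + 1/x - 2\<close>, and the theorem is the derivative of this evaluation at \<open>u = 0\<close>.
\<close>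

section \<open>Differentiating series and products termwise\<close>

lemma deriv_suminf_sums:
  fixes f :: "nat \<Rightarrow> complex \<Rightarrow> complex"
  assumes "open S" "z \<in> S" and hol: "\<And>n. f n holomorphic_on S"
    and "\<And>n w. w \<in> S \<Longrightarrow> norm (f n w) \<le> M n" "summable M"
  shows "(\<lambda>n. deriv (f n) z) sums deriv (\<lambda>w. \<Sum>n. f n w) z"
proof -
  have "(\<lambda>N. deriv (\<lambda>w. \<Sum>n<N. f n w) z) \<longlonglongrightarrow> deriv (\<lambda>w. \<Sum>n. f n w) z"
    using assms by (intro deriv_complex_uniform_limit[where A = S] Weierstrass_m_test)
      (auto intro!: always_eventually holomorphic_intros)
  moreover have "deriv (\<lambda>w. \<Sum>n<N. f n w) z = (\<Sum>n<N. deriv (f n) z)" for N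
    using assms by (intro DERIV_imp_deriv DERIV_sum holomorphic_derivI[OF hol])
  ultimately show ?thesis
    by (simp add: sums_def)
qed

lemma convergent_prod_summable_norm:
  fixes f :: "nat \<Rightarrow> 'a :: {real_normed_field, banach}"
  assumes "summable (\<lambda>n. norm (f n - 1))"
  shows "convergent_prod f"
  using assms by (intro abs_convergent_prod_imp_convergent_prod summable_imp_abs_convergent_prod)

lemma LIMSEQ_prodinf:
  fixes f :: "nat \<Rightarrow> 'a :: real_normed_field"
  assumes "convergent_prod f"
  shows "(\<lambda>N. \<Prod>n<N. f n) \<longlonglongrightarrow> prodinf f"
  using convergent_prod_LIMSEQ[OF assms] by (simp add: LIMSEQ_lessThan_iff_atMost)

lemma uniform_limit_prodinf_norm:
  fixes f :: "nat \<Rightarrow> 'a :: topological_space \<Rightarrow> 'b :: {real_normed_field, banach}"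
  assumes "compact K" "\<And>n. continuous_on K (f n)"
    and bound: "\<And>n w. w \<in> K \<Longrightarrow> norm (f n w - 1) \<le> M n" and "summable M"
  shows "uniform_limit K (\<lambda>N w. \<Prod>n<N. f n w) (\<lambda>w. \<Prod>n. f n w) sequentially"
proof -
  have "uniformly_convergent_on K (\<lambda>N w. \<Prod>n<N. f n w)"
    using assms by (intro uniformly_convergent_on_prod' Weierstrass_m_test'[where M = M]) auto
  then obtain P where P: "uniform_limit K (\<lambda>N w. \<Prod>n<N. f n w) P sequentially"
    by (auto simp: uniformly_convergent_on_def)
  have "P w = (\<Prod>n. f n w)" if "w \<in> K" for w
  proof (rule LIMSEQ_unique[OF tendsto_uniform_limitI[OF P that]])
    have "summable (\<lambda>n. norm (f n w - 1))"
      using \<open>summable M\<close> by (rule summable_comparison_test') (use bound[OF that] in simp)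
    then show "(\<lambda>N. \<Prod>n<N. f n w) \<longlonglongrightarrow> (\<Prod>n. f n w)"
      by (intro LIMSEQ_prodinf convergent_prod_summable_norm)
  qed
  with P show ?thesis
    by (metis (no_types, lifting) uniform_limit_cong')
qed

lemma has_field_derivative_prodinf:
  fixes f :: "nat \<Rightarrow> complex \<Rightarrow> complex"
  assumes "open S" "z \<in> S" and hol: "\<And>n. f n holomorphic_on S"
    and bound: "\<And>n w. w \<in> S \<Longrightarrow> norm (f n w - 1) \<le> M n" and "summable M"
    and nonzero: "\<And>n. f n z \<noteq> 0"
  shows "((\<lambda>w. \<Prod>n. f n w) has_field_derivative
           (\<Prod>n. f n z) * (\<Sum>n. deriv (f n) z / f n z)) (at z)"
    and "summable (\<lambda>n. deriv (f n) z / f n z)"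
proof -
  let ?P = "\<lambda>w. \<Prod>n. f n w"
  obtain r where "0 < r" and r: "cball z r \<subseteq> S"
    using \<open>open S\<close> \<open>z \<in> S\<close> open_contains_cball by blast
  have hol_ball: "f n holomorphic_on ball z r" for n
    using hol r by (meson ball_subset_cball holomorphic_on_subset order_trans)
  have lim: "uniform_limit (cball z r) (\<lambda>N w. \<Prod>n<N. f n w) ?P sequentially"
    using r bound \<open>summable M\<close> holomorphic_on_subset[OF hol r]
    by (intro uniform_limit_prodinf_norm[where M = M] holomorphic_on_imp_continuous_on) auto
  have "continuous_on (cball z r) (\<lambda>w. \<Prod>n<N. f n w)
      \<and> (\<lambda>w. \<Prod>n<N. f n w) holomorphic_on ball z r" for N
    using holomorphic_on_subset[OF hol r] hol_ball
    by (auto intro!: continuous_intros holomorphic_intros holomorphic_on_imp_continuous_on)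
  then obtain "?P holomorphic_on ball z r"
    using holomorphic_uniform_limit[OF always_eventually lim] by auto
  then have "(?P has_field_derivative deriv ?P z) (at z)"
    using \<open>0 < r\<close> by (intro holomorphic_derivI) auto
  moreover have "?P z \<noteq> 0"
  proof (intro prodinf_nonzero convergent_prod_summable_norm nonzero)
    show "summable (\<lambda>n. norm (f n z - 1))"
      using \<open>summable M\<close> by (rule summable_comparison_test') (use bound[OF \<open>z \<in> S\<close>] in simp)
  qed
  moreover from this have logderiv: "(\<lambda>n. deriv (f n) z / f n z) sums (deriv ?P z / ?P z)"
    using \<open>0 < r\<close> hol_ball uniform_limit_on_subset[OF lim ball_subset_cball]
    by (intro logderiv_prodinf_complex_uniform_limit) auto
  ultimately show "(?P has_field_derivative ?P z * (\<Sum>n. deriv (f n) z / f n z)) (at z)"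
    by (simp add: sums_iff)
  show "summable (\<lambda>n. deriv (f n) z / f n z)"
    using logderiv by (rule sums_summable)
qed

lemma has_field_derivative_divide_logderiv:
  fixes f g :: "'a :: real_normed_field \<Rightarrow> 'a"
  assumes "(f has_field_derivative f z * a) (at z)" "(g has_field_derivative g z * b) (at z)" "g z \<noteq> 0"
  shows "((\<lambda>w. f w / g w) has_field_derivative f z / g z * (a - b)) (at z)"
proof -
  have "(f z * a * g z - f z * (g z * b)) / (g z * g z) = f z / g z * (a - b)"
    using assms(3) by (simp add: field_simps)
  with DERIV_divide[OF assms] show ?thesis
    by simp
qed

lemma sums_alternating:
  fixes a :: "nat \<Rightarrow> 'a :: real_normed_field"
  assumes "(\<lambda>n. a (2 * n)) sums s" "(\<lambda>n. a (2 * n + 1)) sums t"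
  shows "(\<lambda>m. (-1) ^ m * a m) sums (s - t)"
proof -
  have "(\<lambda>m. if even m then a m else 0) sums s"
    using assms(1) by (subst sums_mono_reindex[of "\<lambda>n. 2 * n", symmetric])
      (auto simp: strict_mono_def elim!: evenE)
  moreover have "(\<lambda>m. if odd m then a m else 0) sums t"
    using assms(2) by (subst sums_mono_reindex[of "\<lambda>n. 2 * n + 1", symmetric])
      (auto simp: strict_mono_def elim!: oddE)
  ultimately have "(\<lambda>m. (if even m then a m else 0) - (if odd m then a m else 0)) sums (s - t)"
    by (rule sums_diff)
  moreover have "(if even m then a m else 0) - (if odd m then a m else 0) = (-1) ^ m * a m" for m
    by simp
  ultimately show ?thesis
    by simp
qed

lemma summable_gaussian:
  fixes x M :: "'a :: {real_normed_field, banach}"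
  assumes "norm x < 1"
  shows "summable (\<lambda>k. x ^ k\<^sup>2 * M ^ k)"
proof (rule summable_comparison_test_ev)
  have "(\<lambda>k. norm (x ^ k * M)) \<longlonglongrightarrow> norm (0 * M)"
    by (intro tendsto_intros LIMSEQ_power_zero assms)
  then have "eventually (\<lambda>k. norm (x ^ k * M) < 1 / 2) sequentially"
    by (rule order_tendstoD) simp
  then show "eventually (\<lambda>k. norm (x ^ k\<^sup>2 * M ^ k) \<le> (1 / 2) ^ k) sequentially"
  proof eventually_elim
    case (elim k)
    have "norm (x ^ k\<^sup>2 * M ^ k) = norm (x ^ k * M) ^ k"
      by (simp add: norm_power[symmetric] power_mult_distrib power_mult[symmetric] power2_eq_square)
    also have "\<dots> \<le> (1 / 2) ^ k"
      using elim by (intro power_mono) auto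
    finally show ?case .
  qed
qed (simp add: summable_geometric)

section \<open>Shifted factorials\<close>

lemma norm_mult_power_le:
  fixes x p :: "'a :: real_normed_div_algebra"
  assumes "norm p \<le> 1"
  shows "norm (x * p ^ n) \<le> norm x"
  using assms by (simp add: norm_mult norm_power mult_left_le power_le_one)

lemma norm_power_less_one: "norm q < 1 \<Longrightarrow> 0 < n \<Longrightarrow> norm (q ^ n) < 1"
  for q :: "'a :: real_normed_div_algebra"
  by (simp add: norm_power power_less_one_iff)

lemma power_neq_one: "norm q < 1 \<Longrightarrow> 0 < n \<Longrightarrow> q ^ n \<noteq> 1"
  for q :: "'a :: real_normed_div_algebra"
  using norm_power_less_one[of q n] by auto

lemma summable_norm_geometric:
  fixes x p :: "'a :: real_normed_div_algebra"
  assumes "norm p < 1"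
  shows "summable (\<lambda>n. norm (x * p ^ n))"
  using assms by (simp add: norm_mult norm_power summable_geometric summable_mult)

lemma mult_power_neq_one:
  fixes x p :: "'a :: real_normed_div_algebra"
  assumes "norm p < 1" "norm x < 1"
  shows "x * p ^ n \<noteq> 1"
  using norm_mult_power_le[of p x n] assms by auto

lemma qpoch_0 [simp]: "qpoch x p 0 = 1"
  by (simp add: qpoch_def)

lemma qpoch_Suc: "qpoch x p (Suc n) = qpoch x p n * (1 - x * p ^ n)"
  by (simp add: qpoch_def)

lemma qpoch_add: "qpoch x p (m + n) = qpoch x p m * qpoch (x * p ^ m) p n"
  by (induction n) (simp_all add: qpoch_Suc power_add mult_ac)

lemma qpoch_nonzero:
  assumes "norm p < 1" "norm x < 1"
  shows "qpoch x p n \<noteq> 0"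
  using mult_power_neq_one[OF assms] by (simp add: qpoch_def)

lemma qpoch_mult: "qpoch x p (n * m) = (\<Prod>j<m. qpoch (x * p ^ j) (p ^ m) n)"
proof -
  have "qpoch x p (n * m) = (\<Prod>i<n. \<Prod>k\<in>{i * m..<i * m + m}. 1 - x * p ^ k)"
    unfolding qpoch_def by (rule prod.nat_group[symmetric])
  also have "\<dots> = (\<Prod>i<n. \<Prod>j<m. 1 - x * p ^ j * (p ^ m) ^ i)"
    by (simp add: prod.atLeastLessThan_shift_0[of _ "_ * m"] atLeast0LessThan
        power_add power_mult[symmetric] mult_ac)
  also have "\<dots> = (\<Prod>j<m. qpoch (x * p ^ j) (p ^ m) n)"
    unfolding qpoch_def by (rule prod.swap)
  finally show ?thesis .
qed

lemma convergent_prod_qpoch_inf: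
  fixes x p :: complex
  assumes "norm p < 1"
  shows "convergent_prod (\<lambda>i. 1 - x * p ^ i)"
  using summable_norm_geometric[OF assms] by (intro convergent_prod_summable_norm) simp

lemma qpoch_tendsto:
  assumes "norm p < 1"
  shows "qpoch x p \<longlonglongrightarrow> qpoch_inf x p"
  using LIMSEQ_prodinf[OF convergent_prod_qpoch_inf[OF assms]]
  unfolding qpoch_def[abs_def] qpoch_inf_def .

lemma qpoch_inf_nonzero:
  assumes "norm p < 1" "norm x < 1"
  shows "qpoch_inf x p \<noteq> 0"
  unfolding qpoch_inf_def using mult_power_neq_one[OF assms]
  by (intro prodinf_nonzero convergent_prod_qpoch_inf assms) simp

lemma qpoch_inf_split:
  assumes "norm p < 1"
  shows "qpoch_inf x p = qpoch x p m * qpoch_inf (x * p ^ m) p"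
proof (rule LIMSEQ_unique)
  show "(\<lambda>n. qpoch x p (n + m)) \<longlonglongrightarrow> qpoch_inf x p"
    using qpoch_tendsto[OF assms] by (rule LIMSEQ_ignore_initial_segment)
  show "(\<lambda>n. qpoch x p (n + m)) \<longlonglongrightarrow> qpoch x p m * qpoch_inf (x * p ^ m) p"
    unfolding add.commute[of _ m] qpoch_add by (intro tendsto_intros qpoch_tendsto assms)
qed

lemma qpoch_inf_multisection:
  assumes "norm p < 1" "0 < m"
  shows "qpoch_inf x p = (\<Prod>j<m. qpoch_inf (x * p ^ j) (p ^ m))"
proof (rule LIMSEQ_unique)
  show "(\<lambda>n. qpoch x p (n * m)) \<longlonglongrightarrow> qpoch_inf x p"
    using LIMSEQ_subseq_LIMSEQ[OF qpoch_tendsto[OF assms(1)], of "\<lambda>n. n * m"] assms(2)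
    by (simp add: o_def strict_mono_def)
  show "(\<lambda>n. qpoch x p (n * m)) \<longlonglongrightarrow> (\<Prod>j<m. qpoch_inf (x * p ^ j) (p ^ m))"
    unfolding qpoch_mult by (intro tendsto_prod qpoch_tendsto norm_power_less_one assms)
qed

text \<open>With \<open>u = x + 1/x - 2\<close> this is \<open>(1 - xy)(1 - y/x)\<close>.\<close>

definition quad :: "complex \<Rightarrow> complex \<Rightarrow> complex" where
  "quad u y = (1 - y)\<^sup>2 - u * y"

definition quad_poch :: "complex \<Rightarrow> complex \<Rightarrow> complex \<Rightarrow> nat \<Rightarrow> complex" where
  "quad_poch u x p n = (\<Prod>i<n. quad u (x * p ^ i))"

definition quad_poch_inf :: "complex \<Rightarrow> complex \<Rightarrow> complex \<Rightarrow> complex" where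
  "quad_poch_inf u x p = (\<Prod>i. quad u (x * p ^ i))"

lemma quad_zero: "quad 0 y = (1 - y)\<^sup>2"
  by (simp add: quad_def)

lemma norm_quad_minus_one_le: "norm (quad u y - 1) \<le> (norm y + 2 + norm u) * norm y"
proof -
  have "quad u y - 1 = (y - 2 - u) * y"
    by (simp add: quad_def power2_eq_square algebra_simps)
  moreover have "norm (y - 2 - u) \<le> norm y + 2 + norm u"
    using norm_triangle_ineq4[of "y - 2" u] norm_triangle_ineq4[of y 2] by simp
  ultimately show ?thesis
    by (simp add: norm_mult mult_right_mono)
qed

lemma norm_quad_ge:
  assumes "norm y \<le> \<rho>" "\<rho> < 1" "norm u \<le> (1 - \<rho>)\<^sup>2 / 2"
  shows "(1 - \<rho>)\<^sup>2 / 2 \<le> norm (quad u y)"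
proof -
  have "1 - \<rho> \<le> norm (1 - y)"
    using norm_triangle_ineq2[of 1 y] assms by simp
  then have "(1 - \<rho>)\<^sup>2 \<le> norm ((1 - y)\<^sup>2)"
    using assms by (simp add: norm_power power_mono)
  moreover have "norm (u * y) \<le> norm u"
    using assms by (simp add: norm_mult mult_left_le)
  moreover have "norm ((1 - y)\<^sup>2) - norm (u * y) \<le> norm (quad u y)"
    unfolding quad_def by (rule norm_triangle_ineq2)
  ultimately show ?thesis using assms by simp
qed

lemma quad_poch_0 [simp]: "quad_poch u x p 0 = 1"
  by (simp add: quad_poch_def)

lemma quad_poch_Suc: "quad_poch u x p (Suc n) = quad_poch u x p n * quad u (x * p ^ n)"
  by (simp add: quad_poch_def)

lemma quad_poch_Suc_shift: "quad_poch u x p (Suc n) = quad u x * quad_poch u (x * p) p n"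
  unfolding quad_poch_def by (subst prod.lessThan_Suc_shift) (simp add: mult_ac)

lemma quad_poch_zero: "quad_poch 0 x p n = (qpoch x p n)\<^sup>2"
  by (simp add: quad_poch_def qpoch_def quad_zero prod_power_distrib)

lemma norm_quad_geometric_minus_one_le:
  assumes "norm p < 1" "norm u \<le> C"
  shows "norm (quad u (x * p ^ n) - 1) \<le> (norm x + 2 + C) * norm (x * p ^ n)"
proof -
  have "norm (x * p ^ n) + 2 + norm u \<le> norm x + 2 + C"
    using norm_mult_power_le[of p x n] assms by simp
  then show ?thesis
    by (rule order_trans[OF norm_quad_minus_one_le mult_right_mono]) simp
qed

lemma convergent_prod_quad_poch_inf:
  assumes "norm p < 1"
  shows "convergent_prod (\<lambda>i. quad u (x * p ^ i))"
proof (rule convergent_prod_summable_norm)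
  show "summable (\<lambda>i. norm (quad u (x * p ^ i) - 1))"
    by (rule summable_comparison_test'[where g = "\<lambda>i. (norm x + 2 + norm u) * norm (x * p ^ i)"])
      (simp_all add: norm_quad_geometric_minus_one_le assms summable_mult summable_norm_geometric)
qed

lemma quad_poch_inf_nonzero:
  assumes "norm p < 1" "\<And>i. quad u (x * p ^ i) \<noteq> 0"
  shows "quad_poch_inf u x p \<noteq> 0"
  unfolding quad_poch_inf_def by (intro prodinf_nonzero convergent_prod_quad_poch_inf assms)

lemma quad_poch_tendsto:
  assumes "norm p < 1"
  shows "quad_poch u x p \<longlonglongrightarrow> quad_poch_inf u x p"
  using LIMSEQ_prodinf[OF convergent_prod_quad_poch_inf[OF assms]]
  unfolding quad_poch_def[abs_def] quad_poch_inf_def .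

lemma quad_poch_inf_head:
  assumes "norm p < 1"
  shows "quad_poch_inf u x p = quad u x * quad_poch_inf u (x * p) p"
proof (rule LIMSEQ_unique)
  show "(\<lambda>n. quad_poch u x p (Suc n)) \<longlonglongrightarrow> quad_poch_inf u x p"
    using quad_poch_tendsto[OF assms] by (rule LIMSEQ_Suc)
  show "(\<lambda>n. quad_poch u x p (Suc n)) \<longlonglongrightarrow> quad u x * quad_poch_inf u (x * p) p"
    unfolding quad_poch_Suc_shift by (intro tendsto_intros quad_poch_tendsto assms)
qed

lemma quad_poch_inf_zero:
  assumes "norm p < 1"
  shows "quad_poch_inf 0 x p = (qpoch_inf x p)\<^sup>2"
proof (rule LIMSEQ_unique[OF quad_poch_tendsto[OF assms]])
  show "quad_poch 0 x p \<longlonglongrightarrow> (qpoch_inf x p)\<^sup>2"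
    unfolding quad_poch_zero[abs_def] by (intro tendsto_intros qpoch_tendsto assms)
qed

lemma has_field_derivative_quad: "((\<lambda>u. quad u y) has_field_derivative - y) (at u)"
  unfolding quad_def by (auto intro!: derivative_eq_intros)

lemma has_field_derivative_quad_poch:
  assumes "\<And>i. quad u (x * p ^ i) \<noteq> 0"
  shows "((\<lambda>u. quad_poch u x p n) has_field_derivative
           - quad_poch u x p n * (\<Sum>i<n. x * p ^ i / quad u (x * p ^ i))) (at u)"
proof -
  have "((\<lambda>u. \<Prod>i<n. quad u (x * p ^ i)) has_field_derivative
      (\<Prod>i<n. quad u (x * p ^ i)) * (\<Sum>i<n. - (x * p ^ i) / quad u (x * p ^ i))) (at u)"
    by (intro has_field_derivative_prod' has_field_derivative_quad assms)
  then show ?thesis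
    by (simp only: quad_poch_def minus_divide_left[symmetric] sum_negf mult_minus_right mult_minus_left)
qed

lemma has_field_derivative_quad_poch_inf:
  assumes p: "norm p < 1" and nonzero: "\<And>i. quad u (x * p ^ i) \<noteq> 0"
  shows "((\<lambda>u. quad_poch_inf u x p) has_field_derivative
           - quad_poch_inf u x p * (\<Sum>i. x * p ^ i / quad u (x * p ^ i))) (at u)"
    and "summable (\<lambda>i. x * p ^ i / quad u (x * p ^ i))"
proof -
  let ?f = "\<lambda>i u. quad u (x * p ^ i)"
  have hol: "?f i holomorphic_on ball u 1" for i
    unfolding quad_def by (intro holomorphic_intros)
  have bound: "norm (?f i w - 1) \<le> (norm x + 2 + (norm u + 1)) * norm (x * p ^ i)"
    if "w \<in> ball u 1" for i w
  proof (rule norm_quad_geometric_minus_one_le[OF p])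
    show "norm w \<le> norm u + 1"
      using that norm_triangle_ineq2[of w u] by (simp add: dist_norm norm_minus_commute)
  qed
  have sum: "summable (\<lambda>i. (norm x + 2 + (norm u + 1)) * norm (x * p ^ i))"
    by (intro summable_mult summable_norm_geometric p)
  note deriv_prod = has_field_derivative_prodinf[OF open_ball _ hol bound sum nonzero]
  have "deriv (?f i) u = - (x * p ^ i)" for i
    by (intro DERIV_imp_deriv has_field_derivative_quad)
  then have logderiv: "deriv (?f i) u / ?f i u = - (x * p ^ i / ?f i u)" for i
    by simp
  show summable: "summable (\<lambda>i. x * p ^ i / ?f i u)"
    using deriv_prod(2) unfolding logderiv by (simp add: summable_minus_iff)
  show "((\<lambda>u. quad_poch_inf u x p) has_field_derivative
      - quad_poch_inf u x p * (\<Sum>i. x * p ^ i / ?f i u)) (at u)"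
    using deriv_prod(1) unfolding logderiv suminf_minus[OF summable] by (simp add: quad_poch_inf_def)
qed

definition koebe :: "complex \<Rightarrow> complex" where
  "koebe y = y / (1 - y)\<^sup>2"

definition koebe_series :: "complex \<Rightarrow> complex \<Rightarrow> complex" where
  "koebe_series x p = (\<Sum>i. koebe (x * p ^ i))"

lemma divide_quad_zero: "y / quad 0 y = koebe y"
  by (simp add: koebe_def quad_zero)

lemma
  assumes p: "norm p < 1" and x: "norm x < 1"
  shows quad_poch_inf_logderiv_zero:
      "((\<lambda>u. quad_poch_inf u x p) has_field_derivative quad_poch_inf 0 x p * - koebe_series x p) (at 0)"
    and koebe_series_sums: "(\<lambda>i. koebe (x * p ^ i)) sums koebe_series x p"
proof -
  have nonzero: "quad 0 (x * p ^ i) \<noteq> 0" for i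
    using mult_power_neq_one[OF p x] by (simp add: quad_zero)
  show "((\<lambda>u. quad_poch_inf u x p) has_field_derivative quad_poch_inf 0 x p * - koebe_series x p) (at 0)"
    using has_field_derivative_quad_poch_inf(1)[OF p nonzero] by (simp add: divide_quad_zero koebe_series_def)
  show "(\<lambda>i. koebe (x * p ^ i)) sums koebe_series x p"
    using has_field_derivative_quad_poch_inf(2)[OF p nonzero]
    by (simp add: divide_quad_zero koebe_series_def summable_sums)
qed

lemma sums_alternating_koebe:
  assumes "norm p < 1"
  shows "(\<lambda>m. (-1) ^ m * koebe (p ^ Suc m)) sums (koebe_series p (p\<^sup>2) - koebe_series (p\<^sup>2) (p\<^sup>2))"
proof (rule sums_alternating)
  have "norm (p\<^sup>2) < 1"
    using norm_power_less_one[OF assms] by simp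
  from koebe_series_sums[OF this assms] koebe_series_sums[OF this this]
  show "(\<lambda>i. koebe (p ^ Suc (2 * i))) sums koebe_series p (p\<^sup>2)"
    "(\<lambda>i. koebe (p ^ Suc (2 * i + 1))) sums koebe_series (p\<^sup>2) (p\<^sup>2)"
    by (simp_all add: power_mult power2_eq_square power_mult_distrib mult_ac)
qed

lemma qint_eq: "q \<noteq> 1 \<Longrightarrow> qint q n = (1 - q ^ n) / (1 - q)"
  by (simp add: qint_def sum_gp_strict)

lemma power_divide_qint_squared:
  assumes "q \<noteq> 1"
  shows "q ^ n / (qint q n)\<^sup>2 = (1 - q)\<^sup>2 * koebe (q ^ n)"
  using assms by (simp add: qint_eq koebe_def power_divide)

lemma suminf_alternating_qint:
  assumes "norm q < 1" "0 < r"
  shows "(\<Sum>m. (-1) ^ m * q ^ (r * Suc m) / (qint q (r * Suc m))\<^sup>2)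
    = (1 - q)\<^sup>2 * (koebe_series (q ^ r) (q ^ (2 * r)) - koebe_series (q ^ (2 * r)) (q ^ (2 * r)))"
proof -
  have "q \<noteq> 1"
    using assms by auto
  then have "(-1) ^ m * q ^ (r * Suc m) / (qint q (r * Suc m))\<^sup>2
      = (1 - q)\<^sup>2 * ((-1) ^ m * koebe ((q ^ r) ^ Suc m))" for m
    using power_divide_qint_squared[of q "r * Suc m"]
    by (simp only: times_divide_eq_right[symmetric] power_mult mult.left_commute not_False_eq_True)
  moreover have "(q ^ r)\<^sup>2 = q ^ (2 * r)"
    by (simp add: power_mult[symmetric] mult.commute)
  ultimately show ?thesis
    using sums_mult[OF sums_alternating_koebe[OF norm_power_less_one[OF assms]]]
    by (simp only: sums_iff)
qed

section \<open>The deformed series and its telescoping certificates\<close>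

definition cubic_weight :: "complex \<Rightarrow> complex \<Rightarrow> complex \<Rightarrow> nat \<Rightarrow> complex" where
  "cubic_weight q u d k =
     q ^ (2 * k\<^sup>2) * quad_poch u q (q\<^sup>2) k * qpoch (q * d) (q\<^sup>2) (2 * k)
       / (qpoch (q\<^sup>2) (q\<^sup>2) (2 * k) * quad_poch u (d * q ^ 6) (q ^ 6) k)"

definition cubic_term :: "complex \<Rightarrow> complex \<Rightarrow> complex \<Rightarrow> nat \<Rightarrow> complex" where
  "cubic_term q u d k = (1 - d * q ^ (8 * k + 1)) * cubic_weight q u d k"

definition cubic_sum :: "complex \<Rightarrow> complex \<Rightarrow> complex \<Rightarrow> complex" where
  "cubic_sum q u d = (\<Sum>k. cubic_term q u d k)"

definition koebe_difference :: "complex \<Rightarrow> nat \<Rightarrow> complex" where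
  "koebe_difference q k = (\<Sum>i<k. koebe (q * (q\<^sup>2) ^ i) - koebe (q ^ 6 * (q ^ 6) ^ i))"

lemma cubic_weight_0 [simp]: "cubic_weight q u d 0 = 1"
  by (simp add: cubic_weight_def)

lemma cubic_term_eq: "cubic_term q u d k = (1 - d * q * (q ^ (2 * k)) ^ 4) * cubic_weight q u d k"
  by (simp add: cubic_term_def power_add power_mult[symmetric] mult_ac)

lemma cubic_weight_Suc:
  fixes q :: complex and k :: nat
  defines "Q \<equiv> q ^ (2 * k)"
  shows "cubic_weight q u d (Suc k) = cubic_weight q u d k *
     (q\<^sup>2 * Q\<^sup>2 * quad u (q * Q) * (1 - d * q * Q\<^sup>2) * (1 - d * q ^ 3 * Q\<^sup>2)
       / ((1 - q\<^sup>2 * Q\<^sup>2) * (1 - q ^ 4 * Q\<^sup>2) * quad u (d * q ^ 6 * Q ^ 3)))"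
proof -
  have powers: "(q\<^sup>2) ^ k = Q" "(q\<^sup>2) ^ (2 * k) = Q\<^sup>2" "(q ^ 6) ^ k = Q ^ 3"
    by (simp_all add: Q_def power_mult[symmetric] mult_ac)
  have gaussian: "q ^ (2 * (Suc k)\<^sup>2) = q ^ (2 * k\<^sup>2) * (q\<^sup>2 * Q\<^sup>2)"
    by (simp add: Q_def power2_eq_square power_add[symmetric] algebra_simps)
  have factorial: "qpoch x (q\<^sup>2) (2 * Suc k)
      = qpoch x (q\<^sup>2) (2 * k) * (1 - x * Q\<^sup>2) * (1 - x * q\<^sup>2 * Q\<^sup>2)" for x
    by (simp add: qpoch_Suc powers mult.assoc)
  have collect: "q * d * q\<^sup>2 = d * q ^ 3" "q\<^sup>2 * q\<^sup>2 = q ^ 4"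
    by (simp_all add: eval_nat_numeral mult_ac)
  show ?thesis
    unfolding cubic_weight_def quad_poch_Suc powers gaussian factorial collect
    by (simp add: divide_inverse mult_ac)
qed

lemma cubic_weight_shift:
  fixes q :: complex and k :: nat
  defines "Q \<equiv> q ^ (2 * k)"
  assumes nonzero: "\<And>n. quad_poch u (d * q ^ 6) (q ^ 6) n \<noteq> 0"
  shows "(1 - q ^ 3 * d) * quad u (d * q ^ 6 * Q ^ 3)
       * ((1 - q * d) * (1 - q ^ 5 * d) * cubic_weight q u (d * q ^ 6) k)
     = quad u (d * q ^ 6) * ((1 - d * q * Q\<^sup>2) * (1 - d * q ^ 3 * Q\<^sup>2) * (1 - d * q ^ 5 * Q\<^sup>2))
       * cubic_weight q u d k"
proof -
  have "qpoch (q * d) (q\<^sup>2) (3 + 2 * k) = qpoch (q * d) (q\<^sup>2) (2 * k + 3)"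
    by (simp only: add.commute)
  moreover have "qpoch x p 3 = (1 - x) * (1 - x * p) * (1 - x * p\<^sup>2)" for x p
    by (simp add: eval_nat_numeral qpoch_Suc mult_ac)
  moreover have "(q\<^sup>2) ^ (2 * k) = Q\<^sup>2"
    by (simp add: Q_def power_mult[symmetric] mult_ac)
  ultimately have factorial:
    "(1 - q ^ 3 * d) * ((1 - q * d) * (1 - q ^ 5 * d) * qpoch (q * (d * q ^ 6)) (q\<^sup>2) (2 * k))
      = qpoch (q * d) (q\<^sup>2) (2 * k)
        * ((1 - d * q * Q\<^sup>2) * (1 - d * q ^ 3 * Q\<^sup>2) * (1 - d * q ^ 5 * Q\<^sup>2))"
    unfolding qpoch_add by (simp add: eval_nat_numeral mult_ac)
  have "(q ^ 6) ^ k = Q ^ 3"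
    by (simp add: Q_def power_mult[symmetric] mult_ac)
  then have "quad_poch u (d * q ^ 6) (q ^ 6) k * quad u (d * q ^ 6 * Q ^ 3)
      = quad u (d * q ^ 6) * quad_poch u (d * q ^ 6 * q ^ 6) (q ^ 6) k"
    using quad_poch_Suc quad_poch_Suc_shift by metis
  then have "quad u (d * q ^ 6 * Q ^ 3) / quad_poch u (d * q ^ 6 * q ^ 6) (q ^ 6) k
      = quad u (d * q ^ 6) / quad_poch u (d * q ^ 6) (q ^ 6) k"
    using nonzero[of k] nonzero[of "Suc k"] by (simp add: field_simps quad_poch_Suc_shift)
  then have "(1 - q ^ 3 * d) * ((1 - q * d) * (1 - q ^ 5 * d) * qpoch (q * (d * q ^ 6)) (q\<^sup>2) (2 * k))
        * (quad u (d * q ^ 6 * Q ^ 3) / quad_poch u (d * q ^ 6 * q ^ 6) (q ^ 6) k)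
      = qpoch (q * d) (q\<^sup>2) (2 * k)
        * ((1 - d * q * Q\<^sup>2) * (1 - d * q ^ 3 * Q\<^sup>2) * (1 - d * q ^ 5 * Q\<^sup>2))
        * (quad u (d * q ^ 6) / quad_poch u (d * q ^ 6) (q ^ 6) k)"
    using factorial by simp
  from arg_cong[OF this, of "(*) (q ^ (2 * k\<^sup>2) * quad_poch u q (q\<^sup>2) k / qpoch (q\<^sup>2) (q\<^sup>2) (2 * k))"]
  show ?thesis
    unfolding cubic_weight_def by (simp add: divide_inverse mult_ac)
qed

definition wz_cert :: "complex \<Rightarrow> complex \<Rightarrow> complex \<Rightarrow> nat \<Rightarrow> complex" where
  "wz_cert q u d k = quad u (d * q ^ 6) * (q * d / (1 - q ^ 3 * d)) * cubic_weight q u d k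
       * ((1 - q ^ (4 * k)) * (q\<^sup>2 - q ^ (4 * k)))"

lemma wz_polynomial_identity:
  "(1 - d * q * Q ^ 4) * quad u (d * q ^ 6 * Q ^ 3) * (1 - q ^ 3 * d)
      - (1 - d * q ^ 7 * Q ^ 4) * ((1 - d * q * Q\<^sup>2) * (1 - d * q ^ 3 * Q\<^sup>2) * (1 - d * q ^ 5 * Q\<^sup>2))
    = q * d * (q ^ 4 * Q\<^sup>2 * quad u (q * Q) * (1 - d * q * Q\<^sup>2) * (1 - d * q ^ 3 * Q\<^sup>2)
      - quad u (d * q ^ 6 * Q ^ 3) * ((1 - Q\<^sup>2) * (q\<^sup>2 - Q\<^sup>2)))"
  unfolding quad_def by algebra

lemma cubic_term_difference:
  fixes q :: complex and k :: nat
  defines "Q \<equiv> q ^ (2 * k)"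
  assumes nonzero: "\<And>n. quad_poch u (d * q ^ 6) (q ^ 6) n \<noteq> 0"
  shows "(1 - q ^ 3 * d) * quad u (d * q ^ 6 * Q ^ 3)
      * (quad u (d * q ^ 6) * cubic_term q u d k
        - (1 - q * d) * (1 - q ^ 5 * d) * cubic_term q u (d * q ^ 6) k)
    = quad u (d * q ^ 6) * cubic_weight q u d k
      * ((1 - d * q * Q ^ 4) * quad u (d * q ^ 6 * Q ^ 3) * (1 - q ^ 3 * d)
        - (1 - d * q ^ 7 * Q ^ 4) * ((1 - d * q * Q\<^sup>2) * (1 - d * q ^ 3 * Q\<^sup>2) * (1 - d * q ^ 5 * Q\<^sup>2)))"
  using cubic_weight_shift[OF nonzero, of k] unfolding cubic_term_eq Q_def[symmetric] by algebra

lemma wz_cert_difference: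
  fixes q :: complex and k :: nat
  defines "Q \<equiv> q ^ (2 * k)"
  assumes q: "norm q < 1" and d: "1 - q ^ 3 * d \<noteq> 0" and quad_nz: "quad u (d * q ^ 6 * Q ^ 3) \<noteq> 0"
  shows "(1 - q ^ 3 * d) * quad u (d * q ^ 6 * Q ^ 3) * (wz_cert q u d (Suc k) - wz_cert q u d k)
    = quad u (d * q ^ 6) * cubic_weight q u d k
      * (q * d * (q ^ 4 * Q\<^sup>2 * quad u (q * Q) * (1 - d * q * Q\<^sup>2) * (1 - d * q ^ 3 * Q\<^sup>2)
        - quad u (d * q ^ 6 * Q ^ 3) * ((1 - Q\<^sup>2) * (q\<^sup>2 - Q\<^sup>2))))"
proof -
  have powers: "q ^ (4 * k) = Q\<^sup>2" "q ^ (4 * Suc k) = q ^ 4 * Q\<^sup>2"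
    "q ^ (4 * k + 2) = q\<^sup>2 * Q\<^sup>2" "q ^ (4 * k + 4) = q ^ 4 * Q\<^sup>2"
    by (simp_all add: Q_def power_add eval_nat_numeral mult_ac)
  have "1 - q\<^sup>2 * Q\<^sup>2 \<noteq> 0" "1 - q ^ 4 * Q\<^sup>2 \<noteq> 0"
    using power_neq_one[OF q, of "4 * k + 2"] power_neq_one[OF q, of "4 * k + 4"]
    unfolding powers by simp_all
  then have "cubic_weight q u d (Suc k) * ((1 - q\<^sup>2 * Q\<^sup>2) * (1 - q ^ 4 * Q\<^sup>2) * quad u (d * q ^ 6 * Q ^ 3))
      = cubic_weight q u d k * (q\<^sup>2 * Q\<^sup>2 * quad u (q * Q) * (1 - d * q * Q\<^sup>2) * (1 - d * q ^ 3 * Q\<^sup>2))"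
    unfolding cubic_weight_Suc Q_def[symmetric] using quad_nz by simp
  moreover have "(1 - q ^ 3 * d) * wz_cert q u d j
      = quad u (d * q ^ 6) * (q * d) * cubic_weight q u d j
        * ((1 - q ^ (4 * j)) * (q\<^sup>2 - q ^ (4 * j)))" for j
    unfolding wz_cert_def using d by simp
  note this[of k, unfolded powers] this[of "Suc k", unfolded powers]
  ultimately show ?thesis
    by algebra
qed

lemma wz_identity:
  assumes q: "norm q < 1" and d: "1 - q ^ 3 * d \<noteq> 0"
    and nonzero: "\<And>n. quad_poch u (d * q ^ 6) (q ^ 6) n \<noteq> 0"
  shows "quad u (d * q ^ 6) * cubic_term q u d k
       - (1 - q * d) * (1 - q ^ 5 * d) * cubic_term q u (d * q ^ 6) k
       = wz_cert q u d (Suc k) - wz_cert q u d k"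
proof -
  have "(q ^ 6) ^ k = (q ^ (2 * k)) ^ 3"
    by (simp add: power_mult[symmetric] mult_ac)
  then have quad_nz: "quad u (d * q ^ 6 * (q ^ (2 * k)) ^ 3) \<noteq> 0"
    using nonzero[of "Suc k"] by (simp add: quad_poch_Suc)
  from cubic_term_difference[OF nonzero, of k]
  have "(1 - q ^ 3 * d) * quad u (d * q ^ 6 * (q ^ (2 * k)) ^ 3)
      * (quad u (d * q ^ 6) * cubic_term q u d k
        - (1 - q * d) * (1 - q ^ 5 * d) * cubic_term q u (d * q ^ 6) k)
    = (1 - q ^ 3 * d) * quad u (d * q ^ 6 * (q ^ (2 * k)) ^ 3) * (wz_cert q u d (Suc k) - wz_cert q u d k)"
    unfolding wz_polynomial_identity wz_cert_difference[OF q d quad_nz] .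
  then show ?thesis
    using d quad_nz by simp
qed

text \<open>
  At \<open>d = q\<^sup>-\<^sup>3\<close> only the term \<open>k = 0\<close> survives, so the limit of the certificate as \<open>d \<rightarrow> q\<^sup>-\<^sup>3\<close>
  telescopes the series at \<open>d = q\<^sup>3\<close>.
\<close>

definition base_cert :: "complex \<Rightarrow> complex \<Rightarrow> nat \<Rightarrow> complex" where
  "base_cert q u k = cubic_weight q u (q ^ 3) k * quad u (q ^ (6 * k + 3)) / (1 - q ^ (4 * k + 2))"

lemma base_polynomial_identity:
  "(1 - q ^ 4 * Q ^ 4) * (1 - q\<^sup>2 * Q\<^sup>2) = quad u (q ^ 3 * Q ^ 3) - q\<^sup>2 * Q\<^sup>2 * quad u (q * Q)"
  unfolding quad_def by algebra

lemma base_identity: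
  assumes q: "norm q < 1" and nonzero: "\<And>i. quad u (q ^ (6 * i + 3)) \<noteq> 0"
  shows "cubic_term q u (q ^ 3) k = base_cert q u k - base_cert q u (Suc k)"
proof -
  define Q where "Q = q ^ (2 * k)"
  let ?w = "cubic_weight q u (q ^ 3) k"
  have powers: "q ^ (6 * k + 3) = q ^ 3 * Q ^ 3" "q ^ (6 * Suc k + 3) = q ^ 9 * Q ^ 3"
    "q ^ (4 * k + 2) = q\<^sup>2 * Q\<^sup>2" "q ^ (4 * k + 4) = q ^ 4 * Q\<^sup>2" "q ^ (4 * Suc k + 2) = q ^ 6 * Q\<^sup>2"
    "q ^ 3 * q * Q\<^sup>2 = q ^ 4 * Q\<^sup>2" "q ^ 3 * q ^ 3 * Q\<^sup>2 = q ^ 6 * Q\<^sup>2"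
    "q ^ 3 * q ^ 6 * Q ^ 3 = q ^ 9 * Q ^ 3" "q ^ 3 * q * Q ^ 4 = q ^ 4 * Q ^ 4"
    by (simp_all add: power_add Q_def eval_nat_numeral mult_ac)
  have denominators: "1 - q\<^sup>2 * Q\<^sup>2 \<noteq> 0" "1 - q ^ 4 * Q\<^sup>2 \<noteq> 0" "1 - q ^ 6 * Q\<^sup>2 \<noteq> 0"
    using power_neq_one[OF q, of "4 * k + 2"] power_neq_one[OF q, of "4 * k + 4"]
      power_neq_one[OF q, of "4 * Suc k + 2"]
    unfolding powers by simp_all
  have "quad u (q ^ 9 * Q ^ 3) \<noteq> 0"
    using nonzero[of "Suc k"] unfolding powers .
  then have "base_cert q u (Suc k) = ?w * (q\<^sup>2 * Q\<^sup>2 * quad u (q * Q)) / (1 - q\<^sup>2 * Q\<^sup>2)"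
    unfolding base_cert_def cubic_weight_Suc Q_def[symmetric] powers using denominators by simp
  then have "base_cert q u k - base_cert q u (Suc k)
      = ?w * (quad u (q ^ 3 * Q ^ 3) - q\<^sup>2 * Q\<^sup>2 * quad u (q * Q)) / (1 - q\<^sup>2 * Q\<^sup>2)"
    unfolding base_cert_def[of _ _ k] powers by (simp only: right_diff_distrib diff_divide_distrib)
  also have "\<dots> = (1 - q ^ 4 * Q ^ 4) * ?w"
    unfolding base_polynomial_identity[symmetric] using denominators by simp
  finally show ?thesis
    unfolding cubic_term_eq Q_def[symmetric] powers ..
qed

section \<open>Convergence and the recurrence in \<open>d\<close>\<close>

definition cubic_majorant :: "real \<Rightarrow> nat \<Rightarrow> real" where
  "cubic_majorant \<rho> k = \<rho> ^ (2 * k\<^sup>2) * (40 / (1 - \<rho>) ^ 4) ^ k"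

lemma cubic_majorant_Suc:
  "cubic_majorant \<rho> (Suc k) = cubic_majorant \<rho> k * (\<rho> ^ (4 * k + 2) * (40 / (1 - \<rho>) ^ 4))"
proof -
  have "2 * (Suc k)\<^sup>2 = 2 * k\<^sup>2 + (4 * k + 2)"
    by (simp add: power2_eq_square algebra_simps)
  then show ?thesis
    unfolding cubic_majorant_def power_Suc by (simp only: power_add mult_ac)
qed

lemma summable_cubic_majorant:
  assumes "norm \<rho> < 1"
  shows "summable (cubic_majorant \<rho>)"
proof -
  have "norm (\<rho>\<^sup>2) < 1"
    using assms by (simp add: abs_square_less_1)
  then show ?thesis
    unfolding cubic_majorant_def[abs_def] power_mult by (rule summable_gaussian)
qed

context
  fixes q :: complex
  assumes q: "norm q < 1"
begin

lemma norm_mult_power_le_base: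
  assumes "norm d \<le> 1" "0 < n"
  shows "norm (d * q ^ n) \<le> norm q"
proof -
  have "norm (q ^ n) \<le> norm q"
    using power_decreasing[of 1 n "norm q"] q assms by (simp add: norm_power)
  then show ?thesis
    using mult_mono[of "norm d" 1 "norm (q ^ n)" "norm q"] assms by (simp add: norm_mult)
qed

lemma norm_one_minus_mult_power_le:
  assumes "norm d \<le> 1" "0 < n"
  shows "norm (1 - d * q ^ n) \<le> 2"
  using norm_triangle_ineq4[of 1 "d * q ^ n"] norm_mult_power_le_base[OF assms] q by simp

lemma norm_one_minus_power_ge:
  assumes "0 < n"
  shows "1 - norm q \<le> norm (1 - q ^ n)"
  using norm_triangle_ineq2[of 1 "q ^ n"] norm_mult_power_le_base[of 1 n] assms by simp

lemma power_linear_tendsto_0: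
  assumes "0 < a"
  shows "(\<lambda>k. q ^ (a * k + b)) \<longlonglongrightarrow> 0"
proof -
  have "(\<lambda>k. (q ^ a) ^ k * q ^ b) \<longlonglongrightarrow> 0 * q ^ b"
    using assms by (intro tendsto_intros LIMSEQ_power_zero norm_power_less_one q)
  then show ?thesis
    by (simp add: power_add power_mult)
qed

lemma summable_cubic_term_bound: "summable (\<lambda>k. 2 * cubic_majorant (norm q) k)"
  using q by (intro summable_mult summable_cubic_majorant) auto

context
  fixes u :: complex
  assumes u: "norm u \<le> (1 - norm q)\<^sup>2 / 2"
begin

lemma quad_nonzero:
  assumes "norm y \<le> norm q"
  shows "quad u y \<noteq> 0"
proof -
  have "0 < (1 - norm q)\<^sup>2 / 2"
    using q by simp
  also have "\<dots> \<le> norm (quad u y)"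
    by (rule norm_quad_ge[OF assms q u])
  finally show ?thesis by auto
qed

lemma quad_poch_nonzero:
  assumes "norm x \<le> norm q" "norm p \<le> 1"
  shows "quad_poch u x p n \<noteq> 0"
  using assms unfolding quad_poch_def prod_zero_iff[OF finite_lessThan]
  by (auto dest: quad_nonzero[OF order_trans[OF norm_mult_power_le]])

lemma norm_quad_le:
  assumes "norm y \<le> norm q"
  shows "norm (quad u y) \<le> 5"
proof -
  have "norm u \<le> 1"
    using u q power_le_one[of "1 - norm q" 2] by simp
  then have "(norm y + 2 + norm u) * norm y \<le> 4 * 1"
    using assms q by (intro mult_mono) auto
  then show ?thesis
    using norm_quad_minus_one_le[of u y] norm_triangle_ineq2[of "quad u y" 1] by simp
qed

lemma norm_cubic_weight_Suc_le:
  assumes d: "norm d \<le> 1"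
  shows "norm (cubic_weight q u d (Suc k))
     \<le> norm (cubic_weight q u d k) * (norm q ^ (4 * k + 2) * (40 / (1 - norm q) ^ 4))"
proof -
  define Q where "Q = q ^ (2 * k)"
  have powers: "q\<^sup>2 * Q\<^sup>2 = q ^ (4 * k + 2)" "q ^ 4 * Q\<^sup>2 = q ^ (4 * k + 4)" "q * Q = q ^ (2 * k + 1)"
    "d * q * Q\<^sup>2 = d * q ^ (4 * k + 1)" "d * q ^ 3 * Q\<^sup>2 = d * q ^ (4 * k + 3)"
    "d * q ^ 6 * Q ^ 3 = d * q ^ (6 * k + 6)"
    by (simp_all add: power_add Q_def eval_nat_numeral mult_ac)
  let ?num = "norm (quad u (q ^ (2 * k + 1)))
      * norm (1 - d * q ^ (4 * k + 1)) * norm (1 - d * q ^ (4 * k + 3))"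
  let ?den = "norm (1 - q ^ (4 * k + 2)) * norm (1 - q ^ (4 * k + 4)) * norm (quad u (d * q ^ (6 * k + 6)))"
  have "?num \<le> 5 * 2 * 2"
    using norm_mult_power_le_base[of 1 "2 * k + 1"] d
    by (intro mult_mono norm_quad_le norm_one_minus_mult_power_le) auto
  moreover have "(1 - norm q) * (1 - norm q) * ((1 - norm q)\<^sup>2 / 2) \<le> ?den"
    using norm_quad_ge[OF norm_mult_power_le_base[OF d, of "6 * k + 6"] q u] q
    by (intro mult_mono norm_one_minus_power_ge) auto
  ultimately have "?num / ?den \<le> (5 * 2 * 2) / ((1 - norm q) * (1 - norm q) * ((1 - norm q)\<^sup>2 / 2))"
    using q by (intro frac_le) auto
  also have "\<dots> = 40 / (1 - norm q) ^ 4"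
    by (simp add: eval_nat_numeral)
  finally have "norm (cubic_weight q u d k) * (norm q ^ (4 * k + 2) * (?num / ?den))
      \<le> norm (cubic_weight q u d k) * (norm q ^ (4 * k + 2) * (40 / (1 - norm q) ^ 4))"
    by (intro mult_left_mono) auto
  then show ?thesis
    unfolding cubic_weight_Suc Q_def[symmetric] powers norm_mult norm_divide norm_power
    by (simp only: times_divide_eq_right mult.assoc)
qed

lemma norm_cubic_weight_le:
  assumes d: "norm d \<le> 1"
  shows "norm (cubic_weight q u d k) \<le> cubic_majorant (norm q) k"
proof (induction k)
  case 0
  then show ?case by (simp add: cubic_majorant_def)
next
  case (Suc k)
  have "norm (cubic_weight q u d k) * (norm q ^ (4 * k + 2) * (40 / (1 - norm q) ^ 4))
      \<le> cubic_majorant (norm q) (Suc k)"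
    unfolding cubic_majorant_Suc using Suc.IH by (intro mult_right_mono) auto
  with norm_cubic_weight_Suc_le[OF d] show ?case
    by (rule order_trans)
qed

lemma norm_cubic_term_le:
  assumes "norm d \<le> 1"
  shows "norm (cubic_term q u d k) \<le> 2 * cubic_majorant (norm q) k"
  unfolding cubic_term_def norm_mult using assms
  by (intro mult_mono norm_cubic_weight_le norm_one_minus_mult_power_le) auto

lemma cubic_sum_sums:
  assumes "norm d \<le> 1"
  shows "cubic_term q u d sums cubic_sum q u d"
  unfolding cubic_sum_def
  by (intro summable_sums summable_comparison_test'[OF summable_cubic_term_bound norm_cubic_term_le] assms)

lemma cubic_weight_tendsto_0:
  assumes "norm d \<le> 1"
  shows "cubic_weight q u d \<longlonglongrightarrow> 0"
proof (rule Lim_null_comparison)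
  show "\<forall>\<^sub>F k in sequentially. norm (cubic_weight q u d k) \<le> cubic_majorant (norm q) k"
    by (intro always_eventually allI norm_cubic_weight_le assms)
  show "cubic_majorant (norm q) \<longlonglongrightarrow> 0"
    using q by (intro summable_LIMSEQ_zero summable_cubic_majorant) auto
qed

lemma wz_cert_tendsto_0:
  assumes "norm d \<le> 1"
  shows "wz_cert q u d \<longlonglongrightarrow> 0"
proof -
  have "(\<lambda>k. quad u (d * q ^ 6) * (q * d / (1 - q ^ 3 * d)) * cubic_weight q u d k
       * ((1 - q ^ (4 * k + 0)) * (q\<^sup>2 - q ^ (4 * k + 0)))) \<longlonglongrightarrow>
      quad u (d * q ^ 6) * (q * d / (1 - q ^ 3 * d)) * 0 * ((1 - 0) * (q\<^sup>2 - 0))"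
    by (intro tendsto_intros cubic_weight_tendsto_0 assms power_linear_tendsto_0) auto
  then show ?thesis
    by (simp add: wz_cert_def[abs_def])
qed

lemma base_cert_tendsto_0: "base_cert q u \<longlonglongrightarrow> 0"
proof -
  have "(\<lambda>k. cubic_weight q u (q ^ 3) k
        * ((1 - q ^ (6 * k + 3))\<^sup>2 - u * q ^ (6 * k + 3)) / (1 - q ^ (4 * k + 2)))
      \<longlonglongrightarrow> 0 * ((1 - 0)\<^sup>2 - u * 0) / (1 - 0)"
    using norm_power_less_one[OF q, of 3]
    by (intro tendsto_intros cubic_weight_tendsto_0 power_linear_tendsto_0) auto
  then show ?thesis
    by (simp add: base_cert_def[abs_def] quad_def)
qed

lemma cubic_sum_shift:
  assumes d: "norm d \<le> 1"
  shows "quad u (d * q ^ 6) * cubic_sum q u d = (1 - q * d) * (1 - q ^ 5 * d) * cubic_sum q u (d * q ^ 6)"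
proof -
  let ?D = "\<lambda>k. quad u (d * q ^ 6) * cubic_term q u d k
       - (1 - q * d) * (1 - q ^ 5 * d) * cubic_term q u (d * q ^ 6) k"
  have q3d_neq_one: "1 - q ^ 3 * d \<noteq> 0"
    using norm_mult_power_le_base[OF d, of 3] q by (auto simp: mult.commute)
  have "quad_poch u (d * q ^ 6) (q ^ 6) n \<noteq> 0" for n
    using norm_mult_power_le_base[OF d, of 6] norm_power_less_one[OF q, of 6]
    by (intro quad_poch_nonzero) auto
  then have "?D k = wz_cert q u d (Suc k) - wz_cert q u d k" for k
    by (rule wz_identity[OF q q3d_neq_one])
  then have "?D sums (0 - wz_cert q u d 0)"
    using telescope_sums[OF wz_cert_tendsto_0[OF d]] by simp
  moreover have "wz_cert q u d 0 = 0"
    by (simp add: wz_cert_def)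
  moreover have "norm (d * q ^ 6) \<le> 1"
    using norm_mult_power_le_base[OF d, of 6] q by simp
  then have "?D sums (quad u (d * q ^ 6) * cubic_sum q u d
       - (1 - q * d) * (1 - q ^ 5 * d) * cubic_sum q u (d * q ^ 6))"
    by (intro sums_diff sums_mult cubic_sum_sums d)
  ultimately show ?thesis
    using sums_unique2 by fastforce
qed

lemma cubic_sum_iterate:
  assumes d: "norm d \<le> 1"
  shows "quad_poch u (d * q ^ 6) (q ^ 6) N * cubic_sum q u d
     = qpoch (q * d) (q ^ 6) N * qpoch (q ^ 5 * d) (q ^ 6) N * cubic_sum q u (d * (q ^ 6) ^ N)"
proof (induction N)
  case (Suc N)
  let ?e = "d * (q ^ 6) ^ N"
  have "norm ?e \<le> 1"
    using norm_mult_power_le[of "q ^ 6" d N] norm_power_less_one[OF q, of 6] d by simp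
  then have shift: "quad u (?e * q ^ 6) * cubic_sum q u ?e
      = (1 - q * ?e) * (1 - q ^ 5 * ?e) * cubic_sum q u (?e * q ^ 6)"
    by (rule cubic_sum_shift)
  have "quad_poch u (d * q ^ 6) (q ^ 6) (Suc N) * cubic_sum q u d
     = quad u (?e * q ^ 6) * (quad_poch u (d * q ^ 6) (q ^ 6) N * cubic_sum q u d)"
    by (simp add: quad_poch_Suc mult_ac)
  also have "\<dots> = qpoch (q * d) (q ^ 6) N * qpoch (q ^ 5 * d) (q ^ 6) N
      * (quad u (?e * q ^ 6) * cubic_sum q u ?e)"
    unfolding Suc.IH by (simp add: mult_ac)
  also have "\<dots> = qpoch (q * d) (q ^ 6) (Suc N) * qpoch (q ^ 5 * d) (q ^ 6) (Suc N)
      * cubic_sum q u (d * (q ^ 6) ^ Suc N)"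
    unfolding shift by (simp add: qpoch_Suc mult_ac)
  finally show ?case .
qed simp

lemma continuous_on_cubic_sum: "continuous_on (cball 0 1) (cubic_sum q u)"
proof (rule uniform_limit_theorem)
  show "uniform_limit (cball 0 1) (\<lambda>N d. \<Sum>k<N. cubic_term q u d k) (cubic_sum q u) sequentially"
    unfolding cubic_sum_def[abs_def]
    using norm_cubic_term_le by (intro Weierstrass_m_test[OF _ summable_cubic_term_bound]) simp
  have quad_poch: "quad_poch u (d * q ^ 6) (q ^ 6) k \<noteq> 0" if "d \<in> cball 0 1" for d k
    using norm_mult_power_le_base[of d 6] norm_power_less_one[OF q, of 6] that
    by (intro quad_poch_nonzero) auto
  have qpoch: "qpoch (q\<^sup>2) (q\<^sup>2) n \<noteq> 0" for n
    using norm_power_less_one[OF q, of 2] by (intro qpoch_nonzero) auto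
  have "continuous_on (cball 0 1) (\<lambda>d. quad_poch u (d * q ^ 6) (q ^ 6) k)" for k
    unfolding quad_poch_def quad_def by (intro continuous_intros)
  moreover have "continuous_on (cball 0 1) (\<lambda>d. qpoch (q * d) (q\<^sup>2) (2 * k))" for k
    unfolding qpoch_def by (intro continuous_intros)
  ultimately have "continuous_on (cball 0 1) (\<lambda>d. cubic_term q u d k)" for k
    unfolding cubic_term_def cubic_weight_def
    using quad_poch qpoch by (intro continuous_intros) auto
  then show "\<forall>\<^sub>F N in sequentially. continuous_on (cball 0 1) (\<lambda>d. \<Sum>k<N. cubic_term q u d k)"
    by (intro always_eventually allI continuous_on_sum)
qed simp

lemma cubic_sum_limit:
  assumes d: "norm d \<le> 1"
  shows "quad_poch_inf u (d * q ^ 6) (q ^ 6) * cubic_sum q u d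
     = qpoch_inf (q * d) (q ^ 6) * qpoch_inf (q ^ 5 * d) (q ^ 6) * cubic_sum q u 0"
proof (rule LIMSEQ_unique)
  have norm_q6: "norm (q ^ 6) < 1"
    using norm_power_less_one[OF q, of 6] by simp
  show "(\<lambda>N. quad_poch u (d * q ^ 6) (q ^ 6) N * cubic_sum q u d) \<longlonglongrightarrow>
      quad_poch_inf u (d * q ^ 6) (q ^ 6) * cubic_sum q u d"
    by (intro tendsto_intros quad_poch_tendsto norm_q6)
  have "(\<lambda>N. cubic_sum q u (d * (q ^ 6) ^ N)) \<longlonglongrightarrow> cubic_sum q u 0"
  proof (rule continuous_on_tendsto_compose[OF continuous_on_cubic_sum])
    have "(\<lambda>N. d * (q ^ 6) ^ N) \<longlonglongrightarrow> d * 0"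
      by (intro tendsto_intros LIMSEQ_power_zero norm_q6)
    then show "(\<lambda>N. d * (q ^ 6) ^ N) \<longlonglongrightarrow> 0"
      by simp
    have "norm (d * (q ^ 6) ^ N) \<le> 1" for N
      using norm_mult_power_le[of "q ^ 6" d N] norm_q6 d by simp
    then show "\<forall>\<^sub>F N in sequentially. d * (q ^ 6) ^ N \<in> cball 0 1"
      by (intro always_eventually) simp
  qed simp
  then show "(\<lambda>N. quad_poch u (d * q ^ 6) (q ^ 6) N * cubic_sum q u d) \<longlonglongrightarrow>
      qpoch_inf (q * d) (q ^ 6) * qpoch_inf (q ^ 5 * d) (q ^ 6) * cubic_sum q u 0"
    unfolding cubic_sum_iterate[OF d] by (intro tendsto_intros qpoch_tendsto norm_q6)
qed

lemma cubic_sum_cube: "cubic_sum q u (q ^ 3) = quad u (q ^ 3) / (1 - q\<^sup>2)"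
proof -
  have "quad u (q ^ (6 * i + 3)) \<noteq> 0" for i
    using norm_mult_power_le_base[of 1 "6 * i + 3"] by (intro quad_nonzero) simp
  then have "cubic_term q u (q ^ 3) = (\<lambda>k. base_cert q u k - base_cert q u (Suc k))"
    by (intro ext base_identity q)
  then have "cubic_term q u (q ^ 3) sums (base_cert q u 0 - 0)"
    using telescope_sums'[OF base_cert_tendsto_0] by simp
  then show ?thesis
    by (simp add: cubic_sum_def sums_iff base_cert_def power2_eq_square)
qed

lemma qpoch_inf_mult_cubic_sum_0:
  "qpoch_inf (q\<^sup>2) (q ^ 6) * qpoch_inf (q ^ 4) (q ^ 6) * cubic_sum q u 0 = quad_poch_inf u (q ^ 3) (q ^ 6)"
proof -
  have norm_q6: "norm (q ^ 6) < 1" and norm_q3: "norm (q ^ 3) \<le> 1" and q2_neq_one: "q\<^sup>2 \<noteq> 1"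
    using norm_power_less_one[OF q] power_neq_one[OF q] by (auto simp: less_imp_le)
  have "q * q ^ 3 = q ^ 4" "q ^ 5 * q ^ 3 = q\<^sup>2 * q ^ 6"
    by (simp_all add: eval_nat_numeral mult_ac)
  then have limit: "quad_poch_inf u (q ^ 3 * q ^ 6) (q ^ 6) * (quad u (q ^ 3) / (1 - q\<^sup>2))
      = qpoch_inf (q ^ 4) (q ^ 6) * qpoch_inf (q\<^sup>2 * q ^ 6) (q ^ 6) * cubic_sum q u 0"
    using cubic_sum_limit[OF norm_q3] cubic_sum_cube by simp
  have "quad_poch_inf u (q ^ 3) (q ^ 6)
      = (1 - q\<^sup>2) * (quad_poch_inf u (q ^ 3 * q ^ 6) (q ^ 6) * (quad u (q ^ 3) / (1 - q\<^sup>2)))"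
    using quad_poch_inf_head[OF norm_q6, of u "q ^ 3"] q2_neq_one by simp
  also have "\<dots> = (1 - q\<^sup>2) * qpoch_inf (q\<^sup>2 * q ^ 6) (q ^ 6) * qpoch_inf (q ^ 4) (q ^ 6) * cubic_sum q u 0"
    unfolding limit by simp
  also have "(1 - q\<^sup>2) * qpoch_inf (q\<^sup>2 * q ^ 6) (q ^ 6) = qpoch_inf (q\<^sup>2) (q ^ 6)"
    using qpoch_inf_split[OF norm_q6, of "q\<^sup>2" 1] by (simp add: qpoch_Suc)
  finally show ?thesis
    by simp
qed

lemma cubic_sum_one:
  "cubic_sum q u 1
    = qpoch_inf q (q\<^sup>2) * qpoch_inf (q ^ 6) (q ^ 6) / (qpoch_inf (q\<^sup>2) (q\<^sup>2) * qpoch_inf (q ^ 3) (q ^ 6))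
     * (quad_poch_inf u (q ^ 3) (q ^ 6) / quad_poch_inf u (q ^ 6) (q ^ 6))"
proof -
  have less_one: "norm (q ^ n) < 1" if "0 < n" for n
    using norm_power_less_one[OF q that] .
  have nonzero: "qpoch_inf (q ^ n) (q ^ 6) \<noteq> 0" if "0 < n" for n
    using that by (intro qpoch_inf_nonzero less_one) auto
  have "quad u (q ^ 6 * (q ^ 6) ^ i) \<noteq> 0" for i
    using norm_mult_power_le_base[of 1 "6 + 6 * i"] by (intro quad_nonzero) (simp add: power_add power_mult)
  then have "quad_poch_inf u (q ^ 6) (q ^ 6) \<noteq> 0"
    by (intro quad_poch_inf_nonzero less_one) auto
  moreover have "quad_poch_inf u (q ^ 6) (q ^ 6) * cubic_sum q u 1
      = qpoch_inf q (q ^ 6) * qpoch_inf (q ^ 5) (q ^ 6) * cubic_sum q u 0"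
    using cubic_sum_limit[of 1] by simp
  moreover have "qpoch_inf q (q\<^sup>2)
      = qpoch_inf q (q ^ 6) * qpoch_inf (q ^ 3) (q ^ 6) * qpoch_inf (q ^ 5) (q ^ 6)"
    using qpoch_inf_multisection[OF less_one[of 2], of 3 q]
    by (simp add: eval_nat_numeral mult_ac)
  moreover have "qpoch_inf (q\<^sup>2) (q\<^sup>2)
      = qpoch_inf (q\<^sup>2) (q ^ 6) * qpoch_inf (q ^ 4) (q ^ 6) * qpoch_inf (q ^ 6) (q ^ 6)"
    using qpoch_inf_multisection[OF less_one[of 2], of 3 "q\<^sup>2"]
    by (simp add: eval_nat_numeral mult_ac)
  moreover note qpoch_inf_mult_cubic_sum_0[symmetric]
  ultimately show ?thesis
    using nonzero[of 2] nonzero[of 3] nonzero[of 4] nonzero[of 6] by (simp add: field_simps)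
qed

end

section \<open>The derivative at \<open>u = 0\<close>\<close>

lemma has_field_derivative_cubic_term:
  assumes u: "norm u \<le> (1 - norm q)\<^sup>2 / 2" and d: "norm d \<le> 1"
  shows "((\<lambda>u. cubic_term q u d k) has_field_derivative
     - cubic_term q u d k * (\<Sum>i<k. q * (q\<^sup>2) ^ i / quad u (q * (q\<^sup>2) ^ i)
        - d * q ^ 6 * (q ^ 6) ^ i / quad u (d * q ^ 6 * (q ^ 6) ^ i))) (at u)"
proof -
  let ?N = "\<lambda>u. quad_poch u q (q\<^sup>2) k" and ?E = "\<lambda>u. quad_poch u (d * q ^ 6) (q ^ 6) k"
  let ?a = "\<Sum>i<k. q * (q\<^sup>2) ^ i / quad u (q * (q\<^sup>2) ^ i)"
  let ?b = "\<Sum>i<k. d * q ^ 6 * (q ^ 6) ^ i / quad u (d * q ^ 6 * (q ^ 6) ^ i)"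
  define c where "c = (1 - d * q ^ (8 * k + 1))
      * (q ^ (2 * k\<^sup>2) * qpoch (q * d) (q\<^sup>2) (2 * k) / qpoch (q\<^sup>2) (q\<^sup>2) (2 * k))"
  have term_eq: "cubic_term q u d k = c * (?N u / ?E u)" for u
    by (simp add: cubic_term_def cubic_weight_def c_def divide_inverse mult_ac)
  have small: "norm (q\<^sup>2) \<le> 1" "norm (q ^ 6) \<le> 1" "norm (d * q ^ 6) \<le> norm q"
    using norm_power_less_one[OF q] norm_mult_power_le_base[OF d] by (auto simp: less_imp_le)
  have "quad u (q * (q\<^sup>2) ^ i) \<noteq> 0" "quad u (d * q ^ 6 * (q ^ 6) ^ i) \<noteq> 0" for i
    using small by (auto intro!: quad_nonzero[OF u] intro: order_trans[OF norm_mult_power_le])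
  then have "(?N has_field_derivative ?N u * - ?a) (at u)" "(?E has_field_derivative ?E u * - ?b) (at u)"
    using has_field_derivative_quad_poch by simp_all
  moreover have "?E u \<noteq> 0"
    using small by (intro quad_poch_nonzero[OF u])
  ultimately have "((\<lambda>u. c * (?N u / ?E u)) has_field_derivative c * (?N u / ?E u * (- ?a - - ?b))) (at u)"
    by (intro DERIV_cmult has_field_derivative_divide_logderiv)
  then show ?thesis
    unfolding term_eq sum_subtractf by (simp add: algebra_simps)
qed

lemma deriv_cubic_sum_sums:
  "(\<lambda>k. - cubic_term q 0 1 k * koebe_difference q k) sums deriv (\<lambda>u. cubic_sum q u 1) 0"
proof -
  define r where "r = (1 - norm q)\<^sup>2 / 2"
  have "0 < r"
    using q by (simp add: r_def)
  have "\<exists>D. ((\<lambda>u. cubic_term q u 1 k) has_field_derivative D) (at u)" if "u \<in> ball 0 r" for k u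
    using has_field_derivative_cubic_term[of u 1] that unfolding r_def by auto
  then have "(\<lambda>u. cubic_term q u 1 k) holomorphic_on ball 0 r" for k
    by (simp add: holomorphic_on_open)
  then have "(\<lambda>k. deriv (\<lambda>u. cubic_term q u 1 k) 0) sums deriv (\<lambda>u. \<Sum>k. cubic_term q u 1 k) 0"
    using \<open>0 < r\<close> norm_cubic_term_le[of _ 1]
    by (intro deriv_suminf_sums[OF open_ball _ _ _ summable_cubic_term_bound]) (auto simp: r_def)
  moreover have "deriv (\<lambda>u. cubic_term q u 1 k) 0 = - cubic_term q 0 1 k * koebe_difference q k" for k
    using DERIV_imp_deriv[OF has_field_derivative_cubic_term[of 0 1]]
    by (simp add: divide_quad_zero koebe_difference_def)
  ultimately show ?thesis
    by (simp add: cubic_sum_def)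
qed

lemma deriv_cubic_sum:
  "deriv (\<lambda>u. cubic_sum q u 1) 0
    = cubic_sum q 0 1 * (koebe_series (q ^ 6) (q ^ 6) - koebe_series (q ^ 3) (q ^ 6))"
proof (rule DERIV_imp_deriv)
  let ?P = "\<lambda>n u. quad_poch_inf u (q ^ n) (q ^ 6)" and ?s = "\<lambda>n. koebe_series (q ^ n) (q ^ 6)"
  let ?c = "qpoch_inf q (q\<^sup>2) * qpoch_inf (q ^ 6) (q ^ 6)
      / (qpoch_inf (q\<^sup>2) (q\<^sup>2) * qpoch_inf (q ^ 3) (q ^ 6))"
  define r where "r = (1 - norm q)\<^sup>2 / 2"
  have "0 < r"
    using q by (simp add: r_def)
  have closed_form: "?c * (?P 3 u / ?P 6 u) = cubic_sum q u 1" if "u \<in> ball 0 r" for u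
    using cubic_sum_one that by (simp add: r_def)
  have less_one: "norm (q ^ n) < 1" if "0 < n" for n
    using norm_power_less_one[OF q that] .
  then have "?P 6 0 \<noteq> 0"
    by (simp add: quad_poch_inf_zero qpoch_inf_nonzero)
  then have "((\<lambda>u. ?c * (?P 3 u / ?P 6 u)) has_field_derivative
      ?c * (?P 3 0 / ?P 6 0 * (- ?s 3 - - ?s 6))) (at 0)"
    by (intro DERIV_cmult has_field_derivative_divide_logderiv quad_poch_inf_logderiv_zero less_one) auto
  also have "?c * (?P 3 0 / ?P 6 0 * (- ?s 3 - - ?s 6)) = cubic_sum q 0 1 * (?s 6 - ?s 3)"
    using closed_form[of 0] \<open>0 < r\<close> by (simp only: mult.assoc[symmetric]) simp
  finally show "((\<lambda>u. cubic_sum q u 1) has_field_derivative cubic_sum q 0 1 * (?s 6 - ?s 3)) (at 0)"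
    by (rule has_field_derivative_transform_within_open[where S = "ball 0 r"])
      (use \<open>0 < r\<close> closed_form in auto)
qed

lemma cubic_sum_zero_one:
  "cubic_sum q 0 1 = (1 - q) * (qpoch_inf (q ^ 3) (q\<^sup>2) * qpoch_inf (q ^ 3) (q ^ 6)
     / (qpoch_inf (q\<^sup>2) (q\<^sup>2) * qpoch_inf (q ^ 6) (q ^ 6)))"
proof -
  have less_one: "norm (q\<^sup>2) < 1" "norm (q ^ 3) < 1" "norm (q ^ 6) < 1"
    using norm_power_less_one[OF q] by auto
  have "qpoch_inf q (q\<^sup>2) = (1 - q) * qpoch_inf (q ^ 3) (q\<^sup>2)"
    using qpoch_inf_split[OF less_one(1), of q 1] by (simp add: qpoch_Suc eval_nat_numeral)
  then show ?thesis
    using cubic_sum_one[of 0] qpoch_inf_nonzero less_one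
    by (simp add: quad_poch_inf_zero power2_eq_square)
qed

end

lemma summand_eq_cubic_term:
  assumes "q \<noteq> 1"
  shows "q ^ (2 * k\<^sup>2) * qint q (8 * k + 1)
            * (qpoch q (q\<^sup>2) k ^ 2 * qpoch q (q\<^sup>2) (2 * k))
              / (qpoch (q\<^sup>2) (q\<^sup>2) (2 * k) * qpoch (q ^ 6) (q ^ 6) k ^ 2)
            * (\<Sum>i=1..k. q ^ (2 * i - 1) / (qint q (2 * i - 1))\<^sup>2 - q ^ (6 * i) / (qint q (6 * i))\<^sup>2)
      = (1 - q) * (cubic_term q 0 1 k * koebe_difference q k)"
proof -
  have "(\<Sum>i=1..k. q ^ (2 * i - 1) / (qint q (2 * i - 1))\<^sup>2 - q ^ (6 * i) / (qint q (6 * i))\<^sup>2)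
      = (\<Sum>i=1..k. (1 - q)\<^sup>2 * (koebe (q ^ (2 * i - 1)) - koebe (q ^ (6 * i))))"
    unfolding power_divide_qint_squared[OF assms] right_diff_distrib ..
  also have "\<dots> = (1 - q)\<^sup>2 * koebe_difference q k"
    by (simp add: koebe_difference_def sum.atLeast1_atMost_eq sum_distrib_left power_add power_mult)
  finally show ?thesis
    using assms unfolding cubic_term_def cubic_weight_def quad_poch_zero qint_eq[OF assms]
    by (simp add: power2_eq_square)
qed

theorem theorem1p5:
  fixes q :: complex
  assumes "0 < norm q" and "norm q < 1"
  shows "(\<lambda>m. let k = Suc m in
            q ^ (2 * k\<^sup>2) * qint q (8 * k + 1)
            * (qpoch q (q\<^sup>2) k ^ 2 * qpoch q (q\<^sup>2) (2 * k))
              / (qpoch (q\<^sup>2) (q\<^sup>2) (2 * k) * qpoch (q ^ 6) (q ^ 6) k ^ 2)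
            * (\<Sum>i=1..k. q ^ (2 * i - 1) / (qint q (2 * i - 1))\<^sup>2
                          - q ^ (6 * i) / (qint q (6 * i))\<^sup>2))
         sums
         ((qpoch_inf (q ^ 3) (q\<^sup>2) * qpoch_inf (q ^ 3) (q ^ 6))
            / (qpoch_inf (q\<^sup>2) (q\<^sup>2) * qpoch_inf (q ^ 6) (q ^ 6))
          * (\<Sum>m. let j = Suc m in (-1) ^ (j - 1) * q ^ (3 * j) / (qint q (3 * j))\<^sup>2))"
proof -
  note q = \<open>norm q < 1\<close>
  have "q \<noteq> 1"
    using q by auto
  let ?a = "\<lambda>k. cubic_term q 0 1 k * koebe_difference q k"
  let ?L = "koebe_series (q ^ 3) (q ^ 6) - koebe_series (q ^ 6) (q ^ 6)"
  have "?a sums (cubic_sum q 0 1 * ?L)"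
    using sums_minus[OF deriv_cubic_sum_sums[OF q]] unfolding deriv_cubic_sum[OF q]
    by (simp add: algebra_simps)
  moreover have "koebe_difference q 0 = 0"
    by (simp add: koebe_difference_def)
  ultimately have "(\<lambda>m. ?a (Suc m)) sums (cubic_sum q 0 1 * ?L)"
    using sums_Suc_iff[of ?a] by simp
  from sums_mult[OF this, of "1 - q"] show ?thesis
    unfolding Let_def diff_Suc_1 summand_eq_cubic_term[OF \<open>q \<noteq> 1\<close>] cubic_sum_zero_one[OF q]
    using suminf_alternating_qint[OF q, of 3] by (simp add: power2_eq_square mult_ac)
qed

end
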